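(* Let $\mathcal I$ be a solution iterator for a set $S\subseteq\mathbb{C}^n$ of $d$ candidate approximate solutions of a square polynomial system $F$ defined over $\mathbb{Q}$, let $k$ be the maximum part size, and let $m$ be the number of leaves of the balanced BSP tree constructed for $S$. Consider the Main Algorithm on input $(\mathcal I,k)$: construct a BSP tree $T$ for $\mathcal I$ using the algorithm Build BSP Tree, and then run the algorithm Certify Solution Iterator on $(\mathcal I,T)$. Its space cost (in bits) and its time cost (in numbers of bit lookups, evaluations of $<$, and calls to $\texttt{next}$) are as follows. (a) With bitmasks: the space cost is $d\log_2(m)+384nk$ if certification is done by the Krawczyk method, and $d\log_2(m)+384nk+128k$ if it is done by $\alpha$-certification. In both cases the time cost is $O(dm\log(m)+d\log(m)^3)$ bit lookups, $O(d\log(m))$ evaluations of $<$, and $O(d\log(m))$ calls to $\texttt{next}$. (b) Without bitmasks: the space cost is $64(m-1)+384nk$ if certification is done by the Krawczyk method, and $64(m-1)+384nk+128k$ if it is done by $\alpha$-certification. In both cases the time cost is $0$ bit lookups, $O(dm\log(m))$ evaluations of $<$, and $O(dm)$ calls to $\texttt{next}$.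
   Context: Solution iterator. A solution iterator $\mathcal I$ for a finite set $S=\{s_1,\dots,s_d\}\subseteq\mathbb{C}^n$ is a data structure which holds a single solution $s_i$ in memory and provides a function $\texttt{next}$ which exchanges the solution $s_i$ in memory for $s_{i+1}$. Order and halfspaces. For $\mathbf z,\mathbf w\in\mathbb{C}^n$ write $\mathbf z<\mathbf w$ iff $\mathrm{Re}(z_1)<\mathrm{Re}(w_1)$. Put $H_{\mathbf z,-}=\{\mathbf p:\mathbf p<\mathbf z\}$, $H_{\mathbf z,+}=\{\mathbf p:\mathbf p\not<\mathbf z\}$, and, for a fixed tolerance $\varepsilon>0$ and first standard basis vector $e_1$, $\mathcal H_{\mathbf z,\pm}=H_{\mathbf z-\varepsilon e_1,\pm}$. BSP tree. A binary spatial partitioning (BSP) tree $T$ is a binary tree each of whose internal nodes is labeled by a point $\mathbf z\in\mathbb{C}^n$ (a split), such that the labels of left (resp. right) descendants of a node with split $\mathbf z$ lie in $\mathcal H_{\mathbf z,-}$ (resp. $\mathcal H_{\mathbf z,+}$). The region $R_\nu$ of a node $\nu$ is the intersection of the sets $\mathcal H_{\mathbf z,-}$ over all splits $\mathbf z$ of which $\nu$ is a left descendant and the sets $\mathcal H_{\mathbf z,+}$ over all splits $\mathbf z$ of which $\nu$ is a right descendant. The leaf regions partition $\mathbb{C}^n$. Build BSP Tree. Given $S$ (through $\mathcal I$) and $k$: choose $\mathbf z_1\in\mathbb{C}^n$ and label the root by it; while there is a leaf $\ell$ with $|R_\ell\cap S|>k$, choose a split $\mathbf z\in R_\ell$ and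 assign it to $\ell$, which then has two children. The method of choosing splits is assumed to give a balanced tree: the tree has height $\log_2(m)$ and $m$ leaves, with each leaf region containing $k$ points of $S$ and $mk=d$ (approximately). The cost of choosing the splits is not counted. Without bitmasks, the tree stores for each of its $m-1$ internal nodes the real part of the first coordinate of the split as a $64$-bit float; to find $R_\nu\cap S$ for a node $\nu$ at depth $\delta$ one iterates over $\mathcal I$, with $d$ calls to $\texttt{next}$ and $\delta$ evaluations of $<$ per point, and this is done for all $2m-2$ non-root nodes. With bitmasks, each internal node $\nu$ with split $\mathbf z_\nu$ additionally caches a bit vector of length $|R_\nu\cap S|$, whose $j$-th bit is the outcome of the comparison (in the order $<$) of the split with the $j$-th point of $R_\nu\cap S$, i.e. records to which child this point belongs. All bitmasks at depth $\delta$ are built in one pass over $\mathcal I$, costing one $\texttt{next}$ call, $\delta$ bit lookups and one evaluation of $<$ for each of the $d$ solutions. The space for a bitmasked tree counts the bits of these bit vectors. Certify Solution Iterator. Given $\mathcal I$ and a balanced BSP tree $T$: for each leaf $\ell$ of $T$, collect $R_\ell\cap S$ in memory; using $\alpha$-theory or the Krawczyk method, certify the number of distinct complex (resp. real) candidates in $R_\ell\cap S$ whose certificate regions are contained in $R_\ell$; add these numbers to running totals, which are returned at the end. The certificate region of a candidate $s$ is an interval box $I\ni s$ in $\mathbb{C}^n\cong\mathbb{R}^{2n}$ on which the Newton operator $N_F(\mathbf x)=\mathbf x-\mathrm{Jac}_F(\mathbf x)^{-1}F(\mathbf x)$ is shown to be a contraction (Krawczyk method), or the ball of radius $2\beta(F,s)$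 centered at $s$ ($\alpha$-certification), where $\beta(F,s)$ is the constant of Smale's $\alpha$-theory. Collecting the points of one leaf without bitmasks means iterating over all of $\mathcal I$ and locating each point in $T$ by $\log_2(m)$ evaluations of $<$. With bitmasks it means using an iterator for the leaf which skips the solutions not in the leaf by looking up bits ($\log_2(m)$ lookups per solution of $S$), where skipped solutions do not count as $\texttt{next}$ calls. Checking that a certificate region lies in its leaf region costs two evaluations of $<$. Space conventions. A complex float costs $128$ bits and a real float $64$ bits. At most the solutions of one leaf (at most $k$) are held at a time, each with its $n$ complex coordinates and an interval box given by $2n$ complex numbers; for $\alpha$-certification one also stores, for each of these solutions, the value of $\beta$ as an interval given by two real floats. Other working memory is not counted. *)

theory Defs
  imports
    "HOL-Library.Poly_Mapping"
    "HOL-Library.Tree"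
    "Jordan_Normal_Form.Gauss_Jordan_Elimination"
begin

text \<open>Points of the \<open>n\<close>-dimensional complex space are elements of \<^term>\<open>carrier_vec n\<close>
  of type \<^typ>\<open>complex vec\<close>, so that \<open>n\<close> is an ordinary variable. Coordinates are
  counted from 0.\<close>

section \<open>Polynomial systems over the rationals\<close>

type_synonym mpoly = "(nat \<Rightarrow>\<^sub>0 nat) \<Rightarrow>\<^sub>0 rat"

definition mpoly_vars :: "mpoly \<Rightarrow> nat set" where
  "mpoly_vars p = (\<Union>m \<in> Poly_Mapping.keys p. Poly_Mapping.keys m)"

definition mpoly_eval :: "mpoly \<Rightarrow> complex vec \<Rightarrow> complex" where
  "mpoly_eval p x = (\<Sum>m \<in> Poly_Mapping.keys p. of_rat (Poly_Mapping.lookup p m) *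
      (\<Prod>i \<in> Poly_Mapping.keys m. x $ i ^ Poly_Mapping.lookup m i))"

text \<open>The formal partial derivative. If the variable \<open>j\<close> does not occur in the monomial
  \<open>m\<close>, the (truncated) difference of exponents is irrelevant, as the coefficient is 0.\<close>
definition mpoly_pderiv :: "nat \<Rightarrow> mpoly \<Rightarrow> mpoly" where
  "mpoly_pderiv j p = (\<Sum>m \<in> Poly_Mapping.keys p.
      Poly_Mapping.single (m - Poly_Mapping.single j 1)
        (Poly_Mapping.lookup p m * of_nat (Poly_Mapping.lookup m j)))"

definition square_system :: "nat \<Rightarrow> mpoly list \<Rightarrow> bool" where
  "square_system n F \<longleftrightarrow> length F = n \<and> (\<forall>p \<in> set F. mpoly_vars p \<subseteq> {..<n})"

definition sys_eval :: "nat \<Rightarrow> mpoly list \<Rightarrow> complex vec \<Rightarrow> complex vec" where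
  "sys_eval n F x = vec n (\<lambda>i. mpoly_eval (F ! i) x)"

definition jacobian :: "nat \<Rightarrow> mpoly list \<Rightarrow> complex vec \<Rightarrow> complex mat" where
  "jacobian n F x = mat n n (\<lambda>(i, j). mpoly_eval (mpoly_pderiv j (F ! i)) x)"

text \<open>The value at \<open>vs\<close> of the \<open>k\<close>-th derivative of \<open>F\<close> at \<open>x\<close>, where \<open>k\<close> is the length
  of \<open>vs\<close>, as a multilinear map.\<close>
definition higher_deriv :: "nat \<Rightarrow> mpoly list \<Rightarrow> complex vec \<Rightarrow> complex vec list \<Rightarrow> complex vec" where
  "higher_deriv n F x vs = vec n (\<lambda>i.
     \<Sum>js | set js \<subseteq> {..<n} \<and> length js = length vs.
        mpoly_eval (foldr mpoly_pderiv js (F ! i)) x *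
        (\<Prod>l < length vs. (vs ! l) $ (js ! l)))"

text \<open>Only meaningful where the Jacobian is invertible.\<close>
definition jacobian_inv :: "nat \<Rightarrow> mpoly list \<Rightarrow> complex vec \<Rightarrow> complex mat" where
  "jacobian_inv n F x = the (mat_inverse (jacobian n F x))"

definition newton :: "nat \<Rightarrow> mpoly list \<Rightarrow> complex vec \<Rightarrow> complex vec" where
  "newton n F x = x - jacobian_inv n F x *\<^sub>v sys_eval n F x"

section \<open>Certificate regions\<close>

definition euclid_norm :: "complex vec \<Rightarrow> real" where
  "euclid_norm v = sqrt (\<Sum>i < dim_vec v. (cmod (v $ i))\<^sup>2)"

definition max_norm :: "complex vec \<Rightarrow> real" where
  "max_norm v = (MAX i \<in> {..<dim_vec v}. cmod (v $ i))"

definition smale_beta :: "nat \<Rightarrow> mpoly list \<Rightarrow> complex vec \<Rightarrow> real" where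
  "smale_beta n F x = euclid_norm (jacobian_inv n F x *\<^sub>v sys_eval n F x)"

definition smale_gamma :: "nat \<Rightarrow> mpoly list \<Rightarrow> complex vec \<Rightarrow> real" where
  "smale_gamma n F x = (SUP k \<in> {2..}. root (k - 1)
     ((SUP vs \<in> {vs. length vs = k \<and> set vs \<subseteq> {v \<in> carrier_vec n. euclid_norm v = 1}}.
         euclid_norm (jacobian_inv n F x *\<^sub>v higher_deriv n F x vs)) / fact k))"

definition smale_alpha :: "nat \<Rightarrow> mpoly list \<Rightarrow> complex vec \<Rightarrow> real" where
  "smale_alpha n F x = smale_beta n F x * smale_gamma n F x"

definition interval_box :: "nat \<Rightarrow> complex vec \<Rightarrow> complex vec \<Rightarrow> complex vec set" where
  "interval_box n lo hi = {x \<in> carrier_vec n. \<forall>i<n.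
     Re (lo $ i) \<le> Re (x $ i) \<and> Re (x $ i) \<le> Re (hi $ i) \<and>
     Im (lo $ i) \<le> Im (x $ i) \<and> Im (x $ i) \<le> Im (hi $ i)}"

definition newton_contraction_on :: "nat \<Rightarrow> mpoly list \<Rightarrow> complex vec set \<Rightarrow> bool" where
  "newton_contraction_on n F U \<longleftrightarrow>
     (\<forall>x\<in>U. invertible_mat (jacobian n F x) \<and> newton n F x \<in> U) \<and>
     (\<exists>c<1. \<forall>x\<in>U. \<forall>y\<in>U. max_norm (newton n F x - newton n F y) \<le> c * max_norm (x - y))"

datatype cert_method = Krawczyk | Alpha

fun certificate_region ::
  "nat \<Rightarrow> mpoly list \<Rightarrow> cert_method \<Rightarrow> complex vec \<Rightarrow> complex vec set \<Rightarrow> bool" where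
  "certificate_region n F Krawczyk s U \<longleftrightarrow>
     (\<exists>lo \<in> carrier_vec n. \<exists>hi \<in> carrier_vec n. U = interval_box n lo hi) \<and>
     s \<in> U \<and> newton_contraction_on n F U"
| "certificate_region n F Alpha s U \<longleftrightarrow>
     invertible_mat (jacobian n F s) \<and> smale_alpha n F s < (13 - 3 * sqrt 17) / 4 \<and>
     U = {y \<in> carrier_vec n. euclid_norm (y - s) \<le> 2 * smale_beta n F s}"

text \<open>The numerical procedure that certifies one candidate: it either fails or returns a
  certificate region and a flag. The flag may be set only if the region contains a real zero.
  It need not succeed on every candidate for which a certificate exists.\<close>
type_synonym certifier = "complex vec \<Rightarrow> (complex vec set \<times> bool) option"

definition valid_certifier ::
  "nat \<Rightarrow> mpoly list \<Rightarrow> cert_method \<Rightarrow> certifier \<Rightarrow> bool" where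
  "valid_certifier n F meth cert \<longleftrightarrow>
     (\<forall>s \<in> carrier_vec n. \<forall>U r. cert s = Some (U, r) \<longrightarrow>
        certificate_region n F meth s U \<and>
        (r \<longrightarrow> (\<exists>x\<in>U. sys_eval n F x = 0\<^sub>v n \<and> (\<forall>i<n. x $ i \<in> \<real>))))"

section \<open>Time costs\<close>

datatype counts = Counts (lookups: nat) (evals: nat) (nexts: nat)

instantiation counts :: comm_monoid_add
begin

definition zero_counts :: counts where "0 = Counts 0 0 0"

definition plus_counts :: "counts \<Rightarrow> counts \<Rightarrow> counts" where
  "c + c' = Counts (lookups c + lookups c') (evals c + evals c') (nexts c + nexts c')"

instance by standard (simp_all add: zero_counts_def plus_counts_def)

end

definition bit_lookup :: counts where "bit_lookup = Counts 1 0 0"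
definition less_eval :: counts where "less_eval = Counts 0 1 0"
definition next_call :: counts where "next_call = Counts 0 0 1"

section \<open>Solution iterators\<close>

text \<open>The state of an iterator is the solution it holds in memory.\<close>
record solution_iterator =
  first_solution :: "complex vec"
  next_solution :: "complex vec \<Rightarrow> complex vec"

definition iterates :: "solution_iterator \<Rightarrow> complex vec set \<Rightarrow> bool" where
  "iterates I S \<longleftrightarrow> finite S \<and>
     bij_betw (\<lambda>i. (next_solution I ^^ i) (first_solution I)) {..<card S} S"

text \<open>\<open>scan nxt d s f a\<close> applies the program \<open>f\<close> to \<open>d\<close> successive solutions, starting with
  \<open>s\<close>. The body \<open>f\<close> accounts for the step to the following solution, because steps
  over skipped solutions are free.\<close>
fun scan :: "(complex vec \<Rightarrow> complex vec) \<Rightarrow> nat \<Rightarrow> complex vec \<Rightarrow>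
    (complex vec \<Rightarrow> 'a \<Rightarrow> 'a \<times> counts) \<Rightarrow> 'a \<Rightarrow> 'a \<times> counts" where
  "scan nxt 0 s f a = (a, 0)"
| "scan nxt (Suc i) s f a =
     (let (a', c) = f s a; (a'', c') = scan nxt i (nxt s) f a' in (a'', c + c'))"

definition pass :: "solution_iterator \<Rightarrow> nat \<Rightarrow>
    (complex vec \<Rightarrow> 'a \<Rightarrow> 'a \<times> counts) \<Rightarrow> 'a \<Rightarrow> 'a \<times> counts" where
  "pass I d f a = scan (next_solution I) d (first_solution I) f a"

section \<open>BSP trees\<close>

definition pt_less :: "complex vec \<Rightarrow> complex vec \<Rightarrow> bool" where
  "pt_less z w \<longleftrightarrow> Re (z $ 0) < Re (w $ 0)"

definition goes_left :: "nat \<Rightarrow> real \<Rightarrow> complex vec \<Rightarrow> complex vec \<Rightarrow> bool" where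
  "goes_left n \<epsilon> z p \<longleftrightarrow> pt_less p (z - complex_of_real \<epsilon> \<cdot>\<^sub>v unit_vec n 0)"

definition halfspace :: "nat \<Rightarrow> real \<Rightarrow> complex vec \<Rightarrow> bool \<Rightarrow> complex vec set" where
  "halfspace n \<epsilon> z b = {p \<in> carrier_vec n. goes_left n \<epsilon> z p = b}"

text \<open>A node is addressed by the path leading to it from the root; \<^term>\<open>True\<close> means left.
  The internal nodes are labelled by splits; the labels of masked trees also contain a bit vector.\<close>

type_synonym path = "bool list"
type_synonym split_tree = "complex vec tree"
type_synonym masked_tree = "(complex vec \<times> bool list) tree"

fun leaf_paths :: "'a tree \<Rightarrow> path list" where
  "leaf_paths Leaf = [[]]"
| "leaf_paths (Node l a r) = map ((#) True) (leaf_paths l) @ map ((#) False) (leaf_paths r)"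

fun bsp_tree :: "nat \<Rightarrow> real \<Rightarrow> split_tree \<Rightarrow> bool" where
  "bsp_tree n \<epsilon> Leaf \<longleftrightarrow> True"
| "bsp_tree n \<epsilon> (Node l z r) \<longleftrightarrow> z \<in> carrier_vec n \<and>
     set_tree l \<subseteq> halfspace n \<epsilon> z True \<and> set_tree r \<subseteq> halfspace n \<epsilon> z False \<and>
     bsp_tree n \<epsilon> l \<and> bsp_tree n \<epsilon> r"

fun region :: "nat \<Rightarrow> real \<Rightarrow> split_tree \<Rightarrow> path \<Rightarrow> complex vec set" where
  "region n \<epsilon> T [] = carrier_vec n"
| "region n \<epsilon> (Node l z r) (b # \<pi>) =
     halfspace n \<epsilon> z b \<inter> region n \<epsilon> (if b then l else r) \<pi>"
| "region n \<epsilon> Leaf (b # \<pi>) = {}"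

definition splits :: "masked_tree \<Rightarrow> split_tree" where
  "splits M = map_tree fst M"

text \<open>\<^term>\<open>size1 T\<close> is the number of leaves of \<open>T\<close>.\<close>
definition balanced_bsp_tree :: "nat \<Rightarrow> real \<Rightarrow> split_tree \<Rightarrow> bool" where
  "balanced_bsp_tree n \<epsilon> T \<longleftrightarrow>
     bsp_tree n \<epsilon> T \<and> real (height T) = log 2 (real (size1 T))"

definition overfull ::
  "nat \<Rightarrow> real \<Rightarrow> complex vec set \<Rightarrow> nat \<Rightarrow> split_tree \<Rightarrow> path set" where
  "overfull n \<epsilon> S k T = {\<pi> \<in> set (leaf_paths T). card (region n \<epsilon> T \<pi> \<inter> S) > k}"

text \<open>Turns the leaf at every path \<open>\<pi>\<close> with \<open>\<sigma> \<pi> = Some a\<close> into an internal node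
  with label \<open>a\<close> and two leaves.\<close>
fun graft :: "(path \<Rightarrow> 'a option) \<Rightarrow> 'a tree \<Rightarrow> 'a tree" where
  "graft \<sigma> Leaf = (case \<sigma> [] of None \<Rightarrow> Leaf | Some a \<Rightarrow> Node Leaf a Leaf)"
| "graft \<sigma> (Node l a r) =
     Node (graft (\<lambda>\<pi>. \<sigma> (True # \<pi>)) l) a (graft (\<lambda>\<pi>. \<sigma> (False # \<pi>)) r)"

section \<open>Building BSP trees\<close>

subsection \<open>Without bitmasks\<close>

text \<open>Membership of a point in the region of the node at the given path, by comparison with
  the splits of all proper ancestors of the node.\<close>
fun in_node :: "nat \<Rightarrow> real \<Rightarrow> split_tree \<Rightarrow> path \<Rightarrow> complex vec \<Rightarrow> bool \<times> counts" where
  "in_node n \<epsilon> T [] p = (True, 0)"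
| "in_node n \<epsilon> (Node l z r) (b # \<pi>) p =
     (let (q, c) = in_node n \<epsilon> (if b then l else r) \<pi> p
      in (goes_left n \<epsilon> z p = b \<and> q, less_eval + c))"
| "in_node n \<epsilon> Leaf (b # \<pi>) p = (False, 0)"

definition find_points :: "nat \<Rightarrow> real \<Rightarrow> solution_iterator \<Rightarrow> nat \<Rightarrow> split_tree \<Rightarrow> path \<Rightarrow>
    complex vec list \<times> counts" where
  "find_points n \<epsilon> I d T \<pi> = pass I d
     (\<lambda>p ps. let (q, c) = in_node n \<epsilon> T \<pi> p
             in (if q then ps @ [p] else ps, c + next_call)) []"

text \<open>Points of both children of a node are found once, when the node is split.\<close>
definition find_cost :: "nat \<Rightarrow> real \<Rightarrow> solution_iterator \<Rightarrow> nat \<Rightarrow> split_tree \<Rightarrow> path \<Rightarrow> counts" where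
  "find_cost n \<epsilon> I d T \<pi> =
     snd (find_points n \<epsilon> I d T (\<pi> @ [True])) + snd (find_points n \<epsilon> I d T (\<pi> @ [False]))"

text \<open>The reachable states of the loop: the current tree and the cost so far. The choice of
  the overfull leaf and of its split is arbitrary.\<close>
inductive build_state :: "nat \<Rightarrow> real \<Rightarrow> solution_iterator \<Rightarrow> complex vec set \<Rightarrow> nat \<Rightarrow>
    split_tree \<Rightarrow> counts \<Rightarrow> bool" for n \<epsilon> I S k where
  root: "z \<in> carrier_vec n \<Longrightarrow> T = Node Leaf z Leaf \<Longrightarrow>
    build_state n \<epsilon> I S k T (find_cost n \<epsilon> I (card S) T [])"
| split: "build_state n \<epsilon> I S k T c \<Longrightarrow> \<pi> \<in> overfull n \<epsilon> S k T \<Longrightarrow> z \<in> region n \<epsilon> T \<pi> \<Longrightarrow>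
    T' = graft [\<pi> \<mapsto> z] T \<Longrightarrow>
    build_state n \<epsilon> I S k T' (c + find_cost n \<epsilon> I (card S) T' \<pi>)"

definition build_bsp_tree :: "nat \<Rightarrow> real \<Rightarrow> solution_iterator \<Rightarrow> complex vec set \<Rightarrow> nat \<Rightarrow>
    split_tree \<Rightarrow> counts \<Rightarrow> bool" where
  "build_bsp_tree n \<epsilon> I S k T c \<longleftrightarrow> build_state n \<epsilon> I S k T c \<and> overfull n \<epsilon> S k T = {}"

subsection \<open>With bitmasks\<close>

text \<open>In a pass over the solutions, \<open>pos \<pi>\<close> is the number of solutions that have visited the
  node at \<open>\<pi>\<close>, and hence the position of the current solution in the bit vector of this node.
  \<open>route M \<rho> pos\<close> returns the path of the leaf that the current solution belongs to, if
  \<open>M\<close> is the subtree at \<open>\<rho>\<close>.\<close>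
fun route :: "masked_tree \<Rightarrow> path \<Rightarrow> (path \<Rightarrow> nat) \<Rightarrow> path \<times> (path \<Rightarrow> nat) \<times> counts" where
  "route Leaf \<rho> pos = (\<rho>, pos, 0)"
| "route (Node l (z, bs) r) \<rho> pos =
     (let b = bs ! pos \<rho>;
          (\<pi>, pos', c) = route (if b then l else r) (\<rho> @ [b]) (pos(\<rho> := Suc (pos \<rho>)))
      in (\<pi>, pos', bit_lookup + c))"

text \<open>Assigns the splits \<open>\<sigma>\<close> to leaves and computes the bit vectors of all of them in one
  pass.\<close>
definition grow :: "nat \<Rightarrow> real \<Rightarrow> solution_iterator \<Rightarrow> nat \<Rightarrow> masked_tree \<Rightarrow>
    (path \<Rightarrow> complex vec option) \<Rightarrow> masked_tree \<times> counts" where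
  "grow n \<epsilon> I d M \<sigma> =
     (let ((_, masks), c) = pass I d
        (\<lambda>p (pos, masks).
           let (\<pi>, pos', c) = route M [] pos in
           case \<sigma> \<pi> of
             None \<Rightarrow> ((pos', masks), c + next_call)
           | Some z \<Rightarrow> ((pos', masks(\<pi> := masks \<pi> @ [goes_left n \<epsilon> z p])),
                        c + less_eval + next_call))
        (\<lambda>_. 0, \<lambda>_. [])
      in (graft (\<lambda>\<pi>. map_option (\<lambda>z. (z, masks \<pi>)) (\<sigma> \<pi>)) M, c))"

text \<open>The overfull leaves of a state reached here all have the same depth, so each step
  builds one level.\<close>
inductive masked_build_state :: "nat \<Rightarrow> real \<Rightarrow> solution_iterator \<Rightarrow> complex vec set \<Rightarrow> nat \<Rightarrow>
    masked_tree \<Rightarrow> counts \<Rightarrow> bool" for n \<epsilon> I S k where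
  root: "z \<in> carrier_vec n \<Longrightarrow> grow n \<epsilon> I (card S) Leaf [[] \<mapsto> z] = (M, c) \<Longrightarrow>
    masked_build_state n \<epsilon> I S k M c"
| level: "masked_build_state n \<epsilon> I S k M c \<Longrightarrow>
    overfull n \<epsilon> S k (splits M) \<noteq> {} \<Longrightarrow> dom \<sigma> = overfull n \<epsilon> S k (splits M) \<Longrightarrow>
    (\<And>\<pi> z. \<sigma> \<pi> = Some z \<Longrightarrow> z \<in> region n \<epsilon> (splits M) \<pi>) \<Longrightarrow>
    grow n \<epsilon> I (card S) M \<sigma> = (M', c') \<Longrightarrow>
    masked_build_state n \<epsilon> I S k M' (c + c')"

definition build_masked_bsp_tree :: "nat \<Rightarrow> real \<Rightarrow> solution_iterator \<Rightarrow> complex vec set \<Rightarrow> nat \<Rightarrow>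
    masked_tree \<Rightarrow> counts \<Rightarrow> bool" where
  "build_masked_bsp_tree n \<epsilon> I S k M c \<longleftrightarrow>
     masked_build_state n \<epsilon> I S k M c \<and> overfull n \<epsilon> S k (splits M) = {}"

section \<open>Certifying a solution iterator\<close>

fun locate :: "nat \<Rightarrow> real \<Rightarrow> split_tree \<Rightarrow> complex vec \<Rightarrow> path \<times> counts" where
  "locate n \<epsilon> Leaf p = ([], 0)"
| "locate n \<epsilon> (Node l z r) p =
     (let b = goes_left n \<epsilon> z p; (\<pi>, c) = locate n \<epsilon> (if b then l else r) p
      in (b # \<pi>, less_eval + c))"

definition collect_leaf :: "nat \<Rightarrow> real \<Rightarrow> solution_iterator \<Rightarrow> nat \<Rightarrow> split_tree \<Rightarrow> path \<Rightarrow>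
    complex vec list \<times> counts" where
  "collect_leaf n \<epsilon> I d T \<pi> = pass I d
     (\<lambda>p ps. let (\<rho>, c) = locate n \<epsilon> T p
             in (if \<rho> = \<pi> then ps @ [p] else ps, c + next_call)) []"

definition collect_masked_leaf :: "solution_iterator \<Rightarrow> nat \<Rightarrow> masked_tree \<Rightarrow> path \<Rightarrow>
    complex vec list \<times> counts" where
  "collect_masked_leaf I d M \<pi> =
     (let ((_, ps), c) = pass I d
        (\<lambda>p (pos, ps).
           let (\<rho>, pos', c) = route M [] pos
           in if \<rho> = \<pi> then ((pos', ps @ [p]), c + next_call) else ((pos', ps), c))
        (\<lambda>_. 0, [])
      in (ps, c))"

text \<open>Leaf regions are given by bounds on the real part of the first coordinate, so two
  comparisons decide whether a certificate region lies in \<open>R\<close>.\<close>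
fun certify_candidates :: "certifier \<Rightarrow> complex vec set \<Rightarrow> complex vec list \<Rightarrow>
    (complex vec set \<times> bool) list \<times> counts" where
  "certify_candidates cert R [] = ([], 0)"
| "certify_candidates cert R (s # ss) =
     (let (us, c) = certify_candidates cert R ss in
      case cert s of
        None \<Rightarrow> (us, c)
      | Some (U, r) \<Rightarrow> (if U \<subseteq> R then (U, r) # us else us, less_eval + less_eval + c))"

text \<open>Candidates count as distinct if their certificate regions are disjoint.\<close>
fun distinct_count :: "'a set list \<Rightarrow> 'a set list \<Rightarrow> nat" where
  "distinct_count kept [] = length kept"
| "distinct_count kept (U # Us) =
     (if \<forall>V \<in> set kept. U \<inter> V = {} then distinct_count (U # kept) Us
      else distinct_count kept Us)"

datatype cert_totals = Totals (certified_complex: nat) (certified_real: nat)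

text \<open>The loop over the leaves. Besides the totals it returns the maximal number of solutions
  held at a time.\<close>
fun certify_leaves :: "(path \<Rightarrow> complex vec list \<times> counts) \<Rightarrow> (path \<Rightarrow> complex vec set) \<Rightarrow>
    certifier \<Rightarrow> path list \<Rightarrow> cert_totals \<times> nat \<times> counts" where
  "certify_leaves collect R cert [] = (Totals 0 0, 0, 0)"
| "certify_leaves collect R cert (\<pi> # \<pi>s) =
     (let (ps, c1) = collect \<pi>;
          (us, c2) = certify_candidates cert (R \<pi>) ps;
          (t, peak, c3) = certify_leaves collect R cert \<pi>s
      in (Totals (distinct_count [] (map fst us) + certified_complex t)
                 (distinct_count [] (map fst (filter snd us)) + certified_real t),
          max (length ps) peak, c1 + c2 + c3))"

definition certify_iterator :: "nat \<Rightarrow> real \<Rightarrow> solution_iterator \<Rightarrow> nat \<Rightarrow> certifier \<Rightarrow>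
    split_tree \<Rightarrow> cert_totals \<times> nat \<times> counts" where
  "certify_iterator n \<epsilon> I d cert T =
     certify_leaves (collect_leaf n \<epsilon> I d T) (region n \<epsilon> T) cert (leaf_paths T)"

definition certify_masked_iterator :: "nat \<Rightarrow> real \<Rightarrow> solution_iterator \<Rightarrow> nat \<Rightarrow> certifier \<Rightarrow>
    masked_tree \<Rightarrow> cert_totals \<times> nat \<times> counts" where
  "certify_masked_iterator n \<epsilon> I d cert M =
     certify_leaves (collect_masked_leaf I d M) (region n \<epsilon> (splits M)) cert (leaf_paths M)"

section \<open>The main algorithm and its space cost\<close>

definition complex_bits :: nat where "complex_bits = 128"
definition real_bits :: nat where "real_bits = 64"

text \<open>Storage for one solution: its coordinates, an interval box, and for
  \<open>\<alpha>\<close>-certification an interval containing \<open>\<beta>\<close>.\<close>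
definition solution_bits :: "nat \<Rightarrow> cert_method \<Rightarrow> nat" where
  "solution_bits n meth = n * complex_bits + 2 * n * complex_bits +
     (case meth of Krawczyk \<Rightarrow> 0 | Alpha \<Rightarrow> 2 * real_bits)"

definition tree_bits :: "split_tree \<Rightarrow> nat" where
  "tree_bits T = size T * real_bits"

text \<open>Only the bit vectors are counted.\<close>
fun masked_tree_bits :: "masked_tree \<Rightarrow> nat" where
  "masked_tree_bits Leaf = 0"
| "masked_tree_bits (Node l (z, bs) r) = masked_tree_bits l + length bs + masked_tree_bits r"

text \<open>The two predicates state that the algorithm can construct the tree \<open>T\<close> (or \<open>M\<close>), return
  the totals \<open>t\<close>, use \<open>space\<close> bits and incur the time cost \<open>c\<close>.\<close>

definition main_algorithm :: "nat \<Rightarrow> real \<Rightarrow> solution_iterator \<Rightarrow> complex vec set \<Rightarrow> nat \<Rightarrow>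
    cert_method \<Rightarrow> certifier \<Rightarrow> split_tree \<Rightarrow> cert_totals \<Rightarrow> nat \<Rightarrow> counts \<Rightarrow> bool" where
  "main_algorithm n \<epsilon> I S k meth cert T t space c \<longleftrightarrow>
     (\<exists>c1 c2 peak. build_bsp_tree n \<epsilon> I S k T c1 \<and>
        certify_iterator n \<epsilon> I (card S) cert T = (t, peak, c2) \<and>
        space = tree_bits T + peak * solution_bits n meth \<and> c = c1 + c2)"

definition masked_main_algorithm :: "nat \<Rightarrow> real \<Rightarrow> solution_iterator \<Rightarrow> complex vec set \<Rightarrow> nat \<Rightarrow>
    cert_method \<Rightarrow> certifier \<Rightarrow> masked_tree \<Rightarrow> cert_totals \<Rightarrow> nat \<Rightarrow> counts \<Rightarrow> bool" where
  "masked_main_algorithm n \<epsilon> I S k meth cert M t space c \<longleftrightarrow>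
     (\<exists>c1 c2 peak. build_masked_bsp_tree n \<epsilon> I S k M c1 \<and>
        certify_masked_iterator n \<epsilon> I (card S) cert M = (t, peak, c2) \<and>
        space = masked_tree_bits M + peak * solution_bits n meth \<and> c = c1 + c2)"

text \<open>The method of choosing splits aims at leaf regions with exactly \<open>k\<close> points. Every leaf
  region has at most \<open>k\<close> points when the tree has been built; the maximum part size \<open>k\<close> is
  attained if some leaf region has \<open>k\<close> points.\<close>
definition part_size_attained ::
  "nat \<Rightarrow> real \<Rightarrow> complex vec set \<Rightarrow> nat \<Rightarrow> split_tree \<Rightarrow> bool" where
  "part_size_attained n \<epsilon> S k T \<longleftrightarrow>
     (\<exists>\<pi> \<in> set (leaf_paths T). card (region n \<epsilon> T \<pi> \<inter> S) = k)"

end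

theory Submission
  imports Defs "HOL-Library.Sublist"
begin

text \<open>A balanced tree satisfies \<open>height = log 2 m\<close>, hence is perfectly balanced: all its leaves
  have depth \<open>h = log 2 m\<close>. All costs are then counted per level, per node or per leaf.

  Space. At every level the regions of the nodes partition the solutions, so the bit vectors of
  a level have total length \<open>d\<close> and those of the tree have total length \<open>d * h\<close>
  (\<open>masked_tree_bits_complete\<close>), whereas a tree without bitmasks has \<open>m - 1\<close> splits. When
  the tree has been built no leaf is overfull, so at most \<open>k\<close> solutions are held at a time, and
  exactly \<open>k\<close> if some leaf region contains that many (\<open>peak_le_part_size\<close>).

  Time with bitmasks. Each pass of the construction builds one level (\<open>grow_level\<close>), so there are
  \<open>h\<close> passes, each with \<open>d\<close> calls to \<open>next\<close>, at most \<open>d\<close> comparisons and at most \<open>d * h\<close> lookups.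
  Certification visits the \<open>m\<close> leaves with \<open>d * h\<close> lookups each; as the leaf regions partition the
  solutions, all leaves together need only \<open>d\<close> calls to \<open>next\<close> and \<open>2 * d\<close> comparisons.

  Time without bitmasks. Construction and certification make \<open>2 * (m - 1)\<close> and \<open>m\<close> passes, each
  with \<open>d\<close> calls to \<open>next\<close> and at most \<open>d * h\<close> comparisons. Checking the certificate regions adds at
  most \<open>2 * d\<close> comparisons.

  The root is always split, so \<open>h \<ge> 1\<close>, and this absorbs the terms in which the factor \<open>h\<close> is
  missing. The main work is to show that routing by bits agrees with routing by comparisons
  (\<open>route_correct\<close>): only then is the list collected for a leaf the set of solutions in its
  region.\<close>

section \<open>Passes over the iterator\<close>

lemma counts_simps [simp]:
  "lookups 0 = 0" "evals 0 = 0" "nexts 0 = 0"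
  "lookups (c + c') = lookups c + lookups c'"
  "evals (c + c') = evals c + evals c'"
  "nexts (c + c') = nexts c + nexts c'"
  "lookups bit_lookup = 1" "evals bit_lookup = 0" "nexts bit_lookup = 0"
  "lookups less_eval = 0" "evals less_eval = 1" "nexts less_eval = 0"
  "lookups next_call = 0" "evals next_call = 0" "nexts next_call = 1"
  by (simp_all add: zero_counts_def plus_counts_def bit_lookup_def less_eval_def next_call_def)

definition solutions :: "solution_iterator \<Rightarrow> nat \<Rightarrow> complex vec list" where
  "solutions I d = map (\<lambda>i. (next_solution I ^^ i) (first_solution I)) [0..<d]"

lemma length_solutions [simp]: "length (solutions I d) = d"
  by (simp add: solutions_def)

lemma
  assumes "iterates I S"
  shows distinct_solutions: "distinct (solutions I (card S))"
    and set_solutions: "set (solutions I (card S)) = S"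
  using assms unfolding iterates_def solutions_def bij_betw_def
  by (auto simp: distinct_map atLeast0LessThan)

lemma scan_rule:
  assumes "P ps a c"
    and "\<And>ps p a c a' c'. P ps a c \<Longrightarrow> f p a = (a', c') \<Longrightarrow> P (ps @ [p]) a' (c + c')"
  shows "P (ps @ map (\<lambda>i. (nxt ^^ i) s) [0..<d])
           (fst (scan nxt d s f a)) (c + snd (scan nxt d s f a))"
  using assms(1)
proof (induction d arbitrary: s ps a c)
  case 0
  then show ?case by simp
next
  case (Suc d)
  obtain a' c' where f: "f s a = (a', c')"
    by fastforce
  have "P (ps @ [s]) a' (c + c')"
    using assms(2) Suc.prems f by blast
  from Suc.IH[OF this, of "nxt s"] show ?case
    by (simp add: f split_beta add.assoc map_upt_Suc funpow_Suc_right del: upt_Suc funpow.simps)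
qed

text \<open>The invariant rule for loops over all solutions, where \<open>P qs a c\<close> relates the solutions
  processed so far to the loop variables and to the cost so far. The step also knows the
  solutions \<open>rs\<close> that are still to come, because a bit vector already contains their entries and
  its correctness therefore refers to the whole list.\<close>
lemma pass_rule:
  assumes base: "P [] a 0"
    and step: "\<And>qs p rs a c a' c'. P qs a c \<Longrightarrow> solutions I d = qs @ p # rs \<Longrightarrow>
      f p a = (a', c') \<Longrightarrow> P (qs @ [p]) a' (c + c')"
  shows "P (solutions I d) (fst (pass I d f a)) (snd (pass I d f a))"
proof -
  let ?Q = "\<lambda>qs a c. prefix qs (solutions I d) \<longrightarrow> P qs a c"
  let ?s = "scan (next_solution I) d (first_solution I) f a"
  have "?Q ([] @ map (\<lambda>i. (next_solution I ^^ i) (first_solution I)) [0..<d]) (fst ?s) (0 + snd ?s)"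
  proof (rule scan_rule[where P = ?Q])
    show "?Q [] a 0" using base by simp
  next
    fix qs p a c a' c'
    assume IH: "?Q qs a c" and f: "f p a = (a', c')"
    show "?Q (qs @ [p]) a' (c + c')"
    proof
      assume "prefix (qs @ [p]) (solutions I d)"
      then obtain rs where "solutions I d = qs @ p # rs"
        by (auto simp: prefix_def)
      moreover from this have "P qs a c"
        using IH by (auto simp: prefix_def)
      ultimately show "P (qs @ [p]) a' (c + c')"
        using step f by blast
    qed
  qed
  then show ?thesis by (simp add: pass_def solutions_def)
qed

section \<open>Leaves, their regions, and grafting\<close>

definition leaf_of :: "nat \<Rightarrow> real \<Rightarrow> split_tree \<Rightarrow> complex vec \<Rightarrow> path" where
  "leaf_of n \<epsilon> T p = fst (locate n \<epsilon> T p)"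

lemma leaf_of_simps [simp]:
  "leaf_of n \<epsilon> Leaf p = []"
  "leaf_of n \<epsilon> (Node l z r) p =
     goes_left n \<epsilon> z p # leaf_of n \<epsilon> (if goes_left n \<epsilon> z p then l else r) p"
  by (simp_all add: leaf_of_def Let_def split_beta)

lemma leaf_of_in_leaf_paths: "leaf_of n \<epsilon> T p \<in> set (leaf_paths T)"
  by (induction T) auto

lemma splits_simps [simp]:
  "splits Leaf = Leaf"
  "splits (Node l (z, bs) r) = Node (splits l) z (splits r)"
  "height (splits M) = height M"
  "size1 (splits M) = size1 M"
  by (simp_all add: splits_def)

lemma leaf_paths_splits [simp]: "leaf_paths (splits M) = leaf_paths M"
  unfolding splits_def by (induction M) auto

lemma length_leaf_paths: "length (leaf_paths T) = size1 T"
  by (induction T) auto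

lemma leaf_path_length: "\<pi> \<in> set (leaf_paths T) \<Longrightarrow> length \<pi> \<le> height T"
  by (induction T arbitrary: \<pi>) (auto simp: le_max_iff_disj)

lemma length_leaf_of: "length (leaf_of n \<epsilon> T p) \<le> height T"
  by (simp add: leaf_path_length leaf_of_in_leaf_paths)

text \<open>This replaces regions by filters on the list of solutions, which follow the recursive structure
  of the tree.\<close>
lemma mem_region_iff_leaf_of:
  assumes "\<pi> \<in> set (leaf_paths T)" "p \<in> carrier_vec n"
  shows "p \<in> region n \<epsilon> T \<pi> \<longleftrightarrow> leaf_of n \<epsilon> T p = \<pi>"
  using assms by (induction T arbitrary: \<pi>) (auto simp: halfspace_def)

definition leaf_solutions :: "nat \<Rightarrow> real \<Rightarrow> split_tree \<Rightarrow> path \<Rightarrow> complex vec list \<Rightarrow>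
    complex vec list" where
  "leaf_solutions n \<epsilon> T \<pi> ps = filter (\<lambda>p. leaf_of n \<epsilon> T p = \<pi>) ps"

lemma length_leaf_solutions:
  assumes "iterates I S" "S \<subseteq> carrier_vec n" "\<pi> \<in> set (leaf_paths T)"
  shows "length (leaf_solutions n \<epsilon> T \<pi> (solutions I (card S))) = card (region n \<epsilon> T \<pi> \<inter> S)"
proof -
  have "set (leaf_solutions n \<epsilon> T \<pi> (solutions I (card S))) = region n \<epsilon> T \<pi> \<inter> S"
    using assms(2) mem_region_iff_leaf_of[OF assms(3)]
    by (auto simp: leaf_solutions_def set_solutions[OF assms(1)])
  moreover have "distinct (leaf_solutions n \<epsilon> T \<pi> (solutions I (card S)))"
    by (simp add: leaf_solutions_def distinct_solutions[OF assms(1)])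
  ultimately show ?thesis
    by (metis distinct_card)
qed

lemma leaf_solutions_Node [simp]:
  "leaf_solutions n \<epsilon> (Node l z r) (b # \<pi>) ps =
     leaf_solutions n \<epsilon> (if b then l else r) \<pi> (filter (\<lambda>p. goes_left n \<epsilon> z p = b) ps)"
  unfolding leaf_solutions_def filter_filter by (rule filter_cong) auto

text \<open>The leaf regions partition the space, so collecting all leaves touches every solution once.\<close>
lemma sum_length_leaf_solutions:
  "(\<Sum>\<pi>\<leftarrow>leaf_paths T. length (leaf_solutions n \<epsilon> T \<pi> ps)) = length ps"
proof (induction T arbitrary: ps)
  case Leaf
  then show ?case by (simp add: leaf_solutions_def)
next
  case (Node l z r)
  then show ?case
    using sum_length_filter_compl[of "goes_left n \<epsilon> z" ps] by (simp add: o_def)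
qed

lemma set_leaf_paths_graft:
  "set (leaf_paths (graft \<sigma> T)) = {\<pi> \<in> set (leaf_paths T). \<sigma> \<pi> = None} \<union>
     {\<rho> @ [b] | \<rho> b. \<rho> \<in> set (leaf_paths T) \<and> \<sigma> \<rho> \<noteq> None}"
proof (induction T arbitrary: \<sigma>)
  case Leaf
  have "b = True \<or> b = False" for b by simp
  then show ?case by (auto split: option.splits)
next
  case (Node l x r)
  show ?case
    unfolding leaf_paths.simps graft.simps set_append set_map Node.IH
    by (auto simp: image_iff Cons_eq_append_conv; blast)
qed

lemma region_graft:
  "\<pi> \<in> set (leaf_paths T) \<Longrightarrow> region n \<epsilon> (graft \<sigma> T) \<pi> = region n \<epsilon> T \<pi>"
  by (induction T arbitrary: \<sigma> \<pi>) auto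

lemma height_graft_le:
  shows "height (graft \<sigma> T) \<le> Suc (height T)"
    and "height T \<le> height (graft \<sigma> T)"
proof -
  have "height T \<le> height (graft \<sigma> T) \<and> height (graft \<sigma> T) \<le> Suc (height T)"
  proof (induction T arbitrary: \<sigma>)
    case (Node l x r)
    show ?case
      using Node.IH(1)[of "\<lambda>\<pi>. \<sigma> (True # \<pi>)"] Node.IH(2)[of "\<lambda>\<pi>. \<sigma> (False # \<pi>)"]
      by (simp add: max_def)
  qed (simp split: option.splits)
  then show "height (graft \<sigma> T) \<le> Suc (height T)" "height T \<le> height (graft \<sigma> T)"
    by simp_all
qed

lemma length_path_less_height_graft:
  assumes "\<pi> \<in> set (leaf_paths T)" "\<sigma> \<pi> \<noteq> None"
  shows "Suc (length \<pi>) \<le> height (graft \<sigma> T)"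
proof -
  have "\<pi> @ [True] \<in> set (leaf_paths (graft \<sigma> T))"
    using assms by (auto simp: set_leaf_paths_graft)
  from leaf_path_length[OF this] show ?thesis by simp
qed

lemma graft_empty [simp]: "graft Map.empty T = T"
  by (induction T) auto

lemma size_graft_single:
  "\<pi> \<in> set (leaf_paths T) \<Longrightarrow> size (graft [\<pi> \<mapsto> z] T) = Suc (size T)"
proof (induction T arbitrary: \<pi>)
  case (Node l x r)
  have "(\<lambda>\<rho>. [b # \<pi>' \<mapsto> z] (b' # \<rho>)) = (if b = b' then [\<pi>' \<mapsto> z] else Map.empty)" for b b' \<pi>'
    by (auto simp: fun_eq_iff)
  with Node show ?case by auto
qed simp

section \<open>Correctness of the bit vectors\<close>

text \<open>The bit vectors of \<open>M\<close> are those that arise when the solutions \<open>ps\<close> are distributed over the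
  tree. With the list as an argument the condition on a subtree has the same form as the one on the
  whole tree, without reference to regions or paths.\<close>
fun records :: "nat \<Rightarrow> real \<Rightarrow> complex vec list \<Rightarrow> masked_tree \<Rightarrow> bool" where
  "records n \<epsilon> ps Leaf \<longleftrightarrow> True"
| "records n \<epsilon> ps (Node l (z, bs) r) \<longleftrightarrow> bs = map (goes_left n \<epsilon> z) ps \<and>
     records n \<epsilon> (filter (\<lambda>p. goes_left n \<epsilon> z p = True) ps) l \<and>
     records n \<epsilon> (filter (\<lambda>p. goes_left n \<epsilon> z p = False) ps) r"

text \<open>The value that the counter \<open>pos \<rho>\<close> must have after the solutions \<open>ps\<close>. The prefix is strict
  because only internal nodes count their visitors.\<close>
definition visits :: "nat \<Rightarrow> real \<Rightarrow> split_tree \<Rightarrow> complex vec list \<Rightarrow> path \<Rightarrow> nat" where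
  "visits n \<epsilon> T ps \<rho> = length (filter (\<lambda>p. strict_prefix \<rho> (leaf_of n \<epsilon> T p)) ps)"

lemma visits_Node:
  "visits n \<epsilon> (Node l z r) ps [] = length ps"
  "visits n \<epsilon> (Node l z r) ps (b # \<rho>) =
     visits n \<epsilon> (if b then l else r) (filter (\<lambda>p. goes_left n \<epsilon> z p = b) ps) \<rho>"
proof -
  show "visits n \<epsilon> (Node l z r) ps [] = length ps"
    by (simp add: visits_def)
  show "visits n \<epsilon> (Node l z r) ps (b # \<rho>) =
     visits n \<epsilon> (if b then l else r) (filter (\<lambda>p. goes_left n \<epsilon> z p = b) ps) \<rho>"
    unfolding visits_def filter_filter by (rule arg_cong[where f = length], rule filter_cong) auto
qed

text \<open>Reading bits instead of comparing leads to the same leaf: if \<open>pos\<close> counts the earlier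
  visitors of every node, then the bit at position \<open>pos \<rho>\<close> of the node at \<open>\<rho>\<close> is the one that was
  recorded for the current solution. The result for \<open>pos'\<close> describes all nodes, including those
  that are not below \<open>\<rho>\<close>, which stay as they are; in the induction step this covers the
  current node and its other subtree.\<close>
lemma route_correct:
  assumes "records n \<epsilon> (qs @ p # rs) M"
    and "\<And>\<tau>. pos (\<rho> @ \<tau>) = visits n \<epsilon> (splits M) qs \<tau>"
  shows "\<exists>pos'. route M \<rho> pos =
      (\<rho> @ leaf_of n \<epsilon> (splits M) p, pos', Counts (length (leaf_of n \<epsilon> (splits M) p)) 0 0) \<and>
    (\<forall>\<tau>. pos' (\<rho> @ \<tau>) = visits n \<epsilon> (splits M) (qs @ [p]) \<tau>) \<and>
    (\<forall>\<tau>. \<not> prefix \<rho> \<tau> \<longrightarrow> pos' \<tau> = pos \<tau>)"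
  using assms
proof (induction M arbitrary: qs rs \<rho> pos)
  case Leaf
  then show ?case by (simp add: zero_counts_def visits_def)
next
  case (Node l x r)
  obtain z bs where x: "x = (z, bs)" by fastforce
  define b where "b = goes_left n \<epsilon> z p"
  define M' where "M' = (if b then l else r)"
  let ?f = "filter (\<lambda>q. goes_left n \<epsilon> z q = b)"
  let ?pos = "pos(\<rho> := Suc (pos \<rho>))"
  have pos: "pos (\<rho> @ \<tau>) = visits n \<epsilon> (Node (splits l) z (splits r)) qs \<tau>" for \<tau>
    using Node.prems(2)[of \<tau>] by (simp add: x)
  have pos_root: "pos \<rho> = length qs"
    using pos[of "[]"] by (simp add: visits_Node)
  have bit: "bs ! pos \<rho> = b"
    using Node.prems(1) by (simp add: x pos_root b_def nth_append)
  have rec: "records n \<epsilon> (?f qs @ p # ?f rs) M'"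
    using Node.prems(1) by (cases b) (auto simp: x M'_def b_def)
  have pos_sub: "?pos ((\<rho> @ [b]) @ \<tau>) = visits n \<epsilon> (splits M') (?f qs) \<tau>" for \<tau>
    using pos[of "b # \<tau>"] by (auto simp: visits_Node M'_def)
  have "\<exists>pos'. route M' (\<rho> @ [b]) ?pos = ((\<rho> @ [b]) @ leaf_of n \<epsilon> (splits M') p, pos',
         Counts (length (leaf_of n \<epsilon> (splits M') p)) 0 0) \<and>
      (\<forall>\<tau>. pos' ((\<rho> @ [b]) @ \<tau>) = visits n \<epsilon> (splits M') (?f qs @ [p]) \<tau>) \<and>
      (\<forall>\<tau>. \<not> prefix (\<rho> @ [b]) \<tau> \<longrightarrow> pos' \<tau> = ?pos \<tau>)"
  proof (cases b)
    case True
    then have M': "M' = l" by (simp add: M'_def)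
    show ?thesis unfolding M'
      by (rule Node.IH(1), rule rec[unfolded M'], rule pos_sub[unfolded M'])
  next
    case False
    then have M': "M' = r" by (simp add: M'_def)
    show ?thesis unfolding M'
      by (rule Node.IH(2), rule rec[unfolded M'], rule pos_sub[unfolded M'])
  qed
  then obtain pos' where pos':
      "route M' (\<rho> @ [b]) ?pos = ((\<rho> @ [b]) @ leaf_of n \<epsilon> (splits M') p, pos',
         Counts (length (leaf_of n \<epsilon> (splits M') p)) 0 0)"
      "\<And>\<tau>. pos' ((\<rho> @ [b]) @ \<tau>) = visits n \<epsilon> (splits M') (?f qs @ [p]) \<tau>"
      "\<And>\<tau>. \<not> prefix (\<rho> @ [b]) \<tau> \<Longrightarrow> pos' \<tau> = ?pos \<tau>"
    by blast
  have leaf: "leaf_of n \<epsilon> (splits (Node l x r)) p = b # leaf_of n \<epsilon> (splits M') p"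
    by (simp add: x b_def M'_def)
  have "route (Node l x r) \<rho> pos = (\<rho> @ leaf_of n \<epsilon> (splits (Node l x r)) p, pos',
      Counts (length (leaf_of n \<epsilon> (splits (Node l x r)) p)) 0 0)"
    using pos'(1) unfolding leaf
    by (simp add: x bit Let_def M'_def[symmetric] plus_counts_def bit_lookup_def)
  moreover have "pos' (\<rho> @ \<tau>) = visits n \<epsilon> (splits (Node l x r)) (qs @ [p]) \<tau>" for \<tau>
  proof (cases \<tau>)
    case Nil
    then show ?thesis
      using pos'(3)[of \<rho>] by (simp add: x visits_Node pos_root)
  next
    case (Cons b' \<tau>')
    show ?thesis
    proof (cases "b' = b")
      case True
      then show ?thesis
        using pos'(2)[of \<tau>'] by (simp add: Cons x visits_Node b_def M'_def)
    next
      case False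
      then have "pos' (\<rho> @ \<tau>) = pos (\<rho> @ \<tau>)"
        using pos'(3)[of "\<rho> @ \<tau>"] by (simp add: Cons)
      then show ?thesis
        using False by (simp add: pos x Cons visits_Node b_def)
    qed
  qed
  moreover have "pos' \<tau> = pos \<tau>" if "\<not> prefix \<rho> \<tau>" for \<tau>
  proof -
    have "\<not> prefix (\<rho> @ [b]) \<tau>" "\<tau> \<noteq> \<rho>"
      using that by (auto dest: append_prefixD)
    with pos'(3) show ?thesis by simp
  qed
  ultimately show ?case by blast
qed

lemma route_root_correct:
  assumes "records n \<epsilon> (qs @ p # rs) M"
  shows "\<exists>c. route M [] (visits n \<epsilon> (splits M) qs) =
      (leaf_of n \<epsilon> (splits M) p, visits n \<epsilon> (splits M) (qs @ [p]), c) \<and>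
    lookups c \<le> height M \<and> evals c = 0 \<and> nexts c = 0"
  using route_correct[OF assms, of "visits n \<epsilon> (splits M) qs" "[]"]
    length_leaf_of[of n \<epsilon> "splits M" p]
  by (fastforce simp: fun_eq_iff)

text \<open>A new node is inserted at a leaf, so its bit vector consists of the comparisons of exactly
  the solutions in this leaf.\<close>
lemma records_graft:
  assumes "records n \<epsilon> ps M"
    and "\<And>\<pi> z. \<sigma> \<pi> = Some z \<Longrightarrow>
      masks \<pi> = map (goes_left n \<epsilon> z) (leaf_solutions n \<epsilon> (splits M) \<pi> ps)"
  shows "records n \<epsilon> ps (graft (\<lambda>\<pi>. map_option (\<lambda>z. (z, masks \<pi>)) (\<sigma> \<pi>)) M)"
  using assms
proof (induction M arbitrary: ps \<sigma> masks)
  case Leaf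
  then show ?case by (auto simp: leaf_solutions_def split: option.splits)
next
  case (Node l x r)
  obtain z bs where x: "x = (z, bs)" by fastforce
  show ?case
    using Node.prems by (auto simp: x intro!: Node.IH)
qed

lemma splits_graft:
  "splits (graft (\<lambda>\<pi>. map_option (\<lambda>z. (z, masks \<pi>)) (\<sigma> \<pi>)) M) = graft \<sigma> (splits M)"
proof (induction M arbitrary: \<sigma> masks)
  case (Node l x r)
  then show ?case by (cases x) simp
qed (auto split: option.splits)

lemma grow_correct:
  assumes "records n \<epsilon> (solutions I d) M" and "grow n \<epsilon> I d M \<sigma> = (M', c)"
  shows "records n \<epsilon> (solutions I d) M'" "splits M' = graft \<sigma> (splits M)"
    and "lookups c \<le> d * height M" "evals c \<le> d" "nexts c = d"
proof -
  let ?T = "splits M"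
  let ?f = "\<lambda>p (pos, masks).
           let (\<pi>, pos', c) = route M [] pos in
           case \<sigma> \<pi> of
             None \<Rightarrow> ((pos', masks), c + next_call)
           | Some z \<Rightarrow> ((pos', masks(\<pi> := masks \<pi> @ [goes_left n \<epsilon> z p])),
                        c + less_eval + next_call)"
  let ?inv = "\<lambda>qs (pos, masks) c. pos = visits n \<epsilon> ?T qs \<and>
      (\<forall>\<pi> z. \<sigma> \<pi> = Some z \<longrightarrow> masks \<pi> = map (goes_left n \<epsilon> z) (leaf_solutions n \<epsilon> ?T \<pi> qs)) \<and>
      lookups c \<le> length qs * height M \<and> evals c \<le> length qs \<and> nexts c = length qs"
  obtain pos masks where pass: "pass I d ?f (\<lambda>_. 0, \<lambda>_. []) = ((pos, masks), c)"
      and M': "M' = graft (\<lambda>\<pi>. map_option (\<lambda>z. (z, masks \<pi>)) (\<sigma> \<pi>)) M"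
    using assms(2) unfolding grow_def Let_def
    by (cases "pass I d ?f (\<lambda>_. 0, \<lambda>_. [])") (auto simp: Let_def split: prod.splits)
  have "?inv (solutions I d) (fst (pass I d ?f (\<lambda>_. 0, \<lambda>_. [])))
      (snd (pass I d ?f (\<lambda>_. 0, \<lambda>_. [])))"
  proof (rule pass_rule[where P = ?inv])
    show "?inv [] (\<lambda>_. 0, \<lambda>_. []) 0"
      by (auto simp: visits_def leaf_solutions_def)
  next
    fix qs p rs a c a' c'
    assume inv: "?inv qs a c" and sols: "solutions I d = qs @ p # rs" and f: "?f p a = (a', c')"
    obtain pos masks where a: "a = (pos, masks)" by fastforce
    with inv have pos: "pos = visits n \<epsilon> ?T qs" by simp
    obtain c1 where "route M [] pos = (leaf_of n \<epsilon> ?T p, visits n \<epsilon> ?T (qs @ [p]), c1)"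
        "lookups c1 \<le> height M" "evals c1 = 0" "nexts c1 = 0"
      using route_root_correct assms(1) pos sols by metis
    with inv f show "?inv (qs @ [p]) a' (c + c')"
      by (auto simp: a leaf_solutions_def split: option.splits)
  qed
  then have inv: "?inv (solutions I d) (pos, masks) c"
    unfolding pass by simp
  then show "lookups c \<le> d * height M" "evals c \<le> d" "nexts c = d"
    by auto
  show "splits M' = graft \<sigma> (splits M)"
    unfolding M' by (rule splits_graft)
  show "records n \<epsilon> (solutions I d) M'"
    unfolding M' using inv by (intro records_graft assms(1)) auto
qed

text \<open>In a perfectly balanced tree the nodes of each level partition the solutions, so the bit
  vectors of one level have total length \<open>length ps\<close>.\<close>
lemma masked_tree_bits_complete:
  assumes "records n \<epsilon> ps M" "Tree.complete M"
  shows "masked_tree_bits M = length ps * height M"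
  using assms
proof (induction M arbitrary: ps)
  case (Node l x r)
  obtain z bs where x: "x = (z, bs)" by fastforce
  let ?L = "filter (\<lambda>p. goes_left n \<epsilon> z p = True) ps"
  let ?R = "filter (\<lambda>p. goes_left n \<epsilon> z p = False) ps"
  have bs: "length bs = length ps" and rec: "records n \<epsilon> ?L l" "records n \<epsilon> ?R r"
    and complete: "Tree.complete l" "Tree.complete r" "height l = height r"
    using Node.prems unfolding x records.simps Tree.complete.simps by simp_all
  have "length ?L + length ?R = length ps"
    using sum_length_filter_compl[of "goes_left n \<epsilon> z" ps] by simp
  then have "length ?L * height r + length ?R * height r = length ps * height r"
    by (metis add_mult_distrib)
  then show ?case
    unfolding x masked_tree_bits.simps Node.IH(1)[OF rec(1) complete(1)]
      Node.IH(2)[OF rec(2) complete(2)] bs complete(3)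
    by (simp add: complete(3))
qed simp

section \<open>Cost of building the trees\<close>

text \<open>Splitting all overfull leaves at once makes the passes correspond to the levels: a leaf
  which is not overfull stays so, hence the overfull leaves are always among the children created
  in the latest pass, which are the deepest nodes. Each pass therefore increases the height by
  exactly 1.\<close>
lemma grow_level:
  fixes T :: split_tree
  assumes "dom \<sigma> = overfull n \<epsilon> S k T" "overfull n \<epsilon> S k T \<noteq> {}"
    and deep: "\<And>\<pi>. \<pi> \<in> overfull n \<epsilon> S k T \<Longrightarrow> length \<pi> = height T"
  shows "height (graft \<sigma> T) = Suc (height T)"
    and "\<And>\<pi>. \<pi> \<in> overfull n \<epsilon> S k (graft \<sigma> T) \<Longrightarrow> length \<pi> = height (graft \<sigma> T)"
proof -
  obtain \<pi> where \<pi>: "\<pi> \<in> overfull n \<epsilon> S k T"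
    using assms(2) by blast
  then have "Suc (height T) \<le> height (graft \<sigma> T)"
    using length_path_less_height_graft[of \<pi> T \<sigma>] deep assms(1) by (auto simp: overfull_def)
  with height_graft_le(1)[of \<sigma> T] show height: "height (graft \<sigma> T) = Suc (height T)"
    by simp
  fix \<pi> assume *: "\<pi> \<in> overfull n \<epsilon> S k (graft \<sigma> T)"
  then consider "\<pi> \<in> set (leaf_paths T)" "\<sigma> \<pi> = None"
    | \<rho> b where "\<pi> = \<rho> @ [b]" "\<sigma> \<rho> \<noteq> None"
    by (auto simp: overfull_def set_leaf_paths_graft)
  then show "length \<pi> = height (graft \<sigma> T)"
  proof cases
    case 1
    then have "\<pi> \<in> dom \<sigma>"
      using * assms(1) by (simp add: overfull_def region_graft)
    with 1 show ?thesis by auto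
  next
    case 2
    then have "\<rho> \<in> overfull n \<epsilon> S k T"
      using assms(1) by auto
    with 2 deep height show ?thesis by simp
  qed
qed

text \<open>The pass that increases the height from \<open>j\<close> to \<open>j + 1\<close> costs at most \<open>card S * j\<close> lookups.
  The sum over \<open>j\<close> is of order \<open>card S * h ^ 2\<close>, where \<open>h\<close> is the final height.\<close>
lemma masked_build_state_invariant:
  assumes "masked_build_state n \<epsilon> I S k M c"
  shows "records n \<epsilon> (solutions I (card S)) M \<and> height M \<ge> 1 \<and>
    (\<forall>\<pi> \<in> overfull n \<epsilon> S k (splits M). length \<pi> = height M) \<and>
    lookups c \<le> card S * (height M)\<^sup>2 \<and> evals c \<le> card S * height M \<and>
    nexts c \<le> card S * height M"
  using assms
proof (induction rule: masked_build_state.induct)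
  case (root z M c)
  have "records n \<epsilon> (solutions I (card S)) Leaf" by simp
  note grow = grow_correct[OF this root(2)]
  have "splits M = Node Leaf z Leaf"
    using grow(2) by simp
  moreover from this have "height M = 1"
    using splits_simps(3)[of M] by simp
  ultimately show ?case
    using grow by (auto simp: overfull_def)
next
  case (level M c \<sigma> M' c')
  have IH: "records n \<epsilon> (solutions I (card S)) M" "height M \<ge> 1"
      "\<And>\<pi>. \<pi> \<in> overfull n \<epsilon> S k (splits M) \<Longrightarrow> length \<pi> = height M"
      "lookups c \<le> card S * (height M)\<^sup>2" "evals c \<le> card S * height M"
      "nexts c \<le> card S * height M"
    using level.IH by auto
  note grow = grow_correct[OF IH(1) level(5)]
  have height: "height M' = Suc (height M)"
    and overfull: "\<And>\<pi>. \<pi> \<in> overfull n \<epsilon> S k (splits M') \<Longrightarrow> length \<pi> = height M'"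
    using grow_level[OF level(3,2)] IH(3) splits_simps(3)[of M'] by (simp_all add: grow(2))
  have "card S * (height M)\<^sup>2 + card S * height M \<le> card S * (height M')\<^sup>2"
    by (simp add: height power2_eq_square algebra_simps)
  with IH(4) grow(3) have "lookups (c + c') \<le> card S * (height M')\<^sup>2"
    by simp
  moreover have "evals (c + c') \<le> card S * height M'" "nexts (c + c') \<le> card S * height M'"
    using IH(5,6) grow(4,5) by (simp_all add: height)
  ultimately show ?case
    using grow(1) height overfull by auto
qed

lemma in_node_cost:
  "lookups (snd (in_node n \<epsilon> T \<pi> p)) = 0 \<and> evals (snd (in_node n \<epsilon> T \<pi> p)) \<le> length \<pi> \<and>
   nexts (snd (in_node n \<epsilon> T \<pi> p)) = 0"
  by (induction n \<epsilon> T \<pi> p rule: in_node.induct) (auto simp: Let_def split_beta)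

lemma find_points_cost:
  "lookups (snd (find_points n \<epsilon> I d T \<pi>)) = 0 \<and>
   evals (snd (find_points n \<epsilon> I d T \<pi>)) \<le> d * length \<pi> \<and>
   nexts (snd (find_points n \<epsilon> I d T \<pi>)) = d"
proof -
  let ?inv = "\<lambda>(qs :: complex vec list) (a :: complex vec list) c.
      lookups c = 0 \<and> evals c \<le> length qs * length \<pi> \<and> nexts c = length qs"
  have "?inv (solutions I d) (fst (find_points n \<epsilon> I d T \<pi>)) (snd (find_points n \<epsilon> I d T \<pi>))"
    unfolding find_points_def
  proof (rule pass_rule[where P = ?inv])
    fix qs p rs a c a' c'
    assume "?inv qs a c"
      and "(let (q, c) = in_node n \<epsilon> T \<pi> p in (if q then a @ [p] else a, c + next_call)) = (a', c')"
    then show "?inv (qs @ [p]) a' (c + c')"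
      using in_node_cost[of n \<epsilon> T \<pi> p] by (auto simp: split_beta)
  qed simp
  then show ?thesis by simp
qed

lemma find_cost_bounds:
  assumes "Suc (length \<pi>) \<le> h"
  shows "lookups (find_cost n \<epsilon> I d T \<pi>) = 0" "evals (find_cost n \<epsilon> I d T \<pi>) \<le> 2 * d * h"
    "nexts (find_cost n \<epsilon> I d T \<pi>) = 2 * d"
proof -
  have "d * Suc (length \<pi>) \<le> d * h"
    using assms by (rule mult_le_mono2)
  then show "lookups (find_cost n \<epsilon> I d T \<pi>) = 0" "evals (find_cost n \<epsilon> I d T \<pi>) \<le> 2 * d * h"
    "nexts (find_cost n \<epsilon> I d T \<pi>) = 2 * d"
    using find_points_cost[of n \<epsilon> I d T "\<pi> @ [True]"] find_points_cost[of n \<epsilon> I d T "\<pi> @ [False]"]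
    unfolding find_cost_def by simp_all
qed

text \<open>The leaves may be split in any order. The cost of a split is bounded uniformly, since the
  paths of the two new leaves are not longer than the height of the tree, which never
  decreases.\<close>
lemma build_state_invariant:
  assumes "build_state n \<epsilon> I S k T c"
  shows "height T \<ge> 1 \<and> lookups c = 0 \<and> evals c \<le> 2 * card S * height T * size T \<and>
    nexts c = 2 * card S * size T"
  using assms
proof (induction rule: build_state.induct)
  case (root z T)
  then show ?case
    using find_cost_bounds[of "[]" 1 n \<epsilon> I "card S" T] by simp
next
  case (split T c \<pi> z T')
  have \<pi>: "\<pi> \<in> set (leaf_paths T)"
    using split(2) by (simp add: overfull_def)
  have size: "size T' = Suc (size T)" and height: "height T \<le> height T'"
    and depth: "Suc (length \<pi>) \<le> height T'"
    using size_graft_single[OF \<pi>] height_graft_le(2) length_path_less_height_graft[OF \<pi>]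
    by (auto simp: split(4))
  have "2 * card S * height T * size T \<le> 2 * card S * height T' * size T"
    using height by simp
  then have "evals c \<le> 2 * card S * height T' * size T"
    using split.IH by (auto intro: order_trans)
  then show ?case
    using split.IH height find_cost_bounds[OF depth, of n \<epsilon> I "card S" T']
    by (simp add: size algebra_simps)
qed

section \<open>Cost of certification\<close>

lemma certify_candidates_cost:
  "lookups (snd (certify_candidates cert R ps)) = 0 \<and>
   evals (snd (certify_candidates cert R ps)) \<le> 2 * length ps \<and>
   nexts (snd (certify_candidates cert R ps)) = 0"
  by (induction ps) (auto simp: Let_def split_beta split: option.splits)

lemma certify_leaves_cost:
  assumes "certify_leaves collect R cert \<pi>s = (t, peak, c)"
  shows "lookups c = (\<Sum>\<pi>\<leftarrow>\<pi>s. lookups (snd (collect \<pi>)))"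
    and "evals c \<le> (\<Sum>\<pi>\<leftarrow>\<pi>s. evals (snd (collect \<pi>)) + 2 * length (fst (collect \<pi>)))"
    and "nexts c = (\<Sum>\<pi>\<leftarrow>\<pi>s. nexts (snd (collect \<pi>)))"
    and "(\<And>\<pi>. \<pi> \<in> set \<pi>s \<Longrightarrow> length (fst (collect \<pi>)) \<le> k) \<Longrightarrow> peak \<le> k"
    and "\<pi> \<in> set \<pi>s \<Longrightarrow> length (fst (collect \<pi>)) \<le> peak"
proof -
  have "lookups c = (\<Sum>\<pi>\<leftarrow>\<pi>s. lookups (snd (collect \<pi>))) \<and>
    evals c \<le> (\<Sum>\<pi>\<leftarrow>\<pi>s. evals (snd (collect \<pi>)) + 2 * length (fst (collect \<pi>))) \<and>
    nexts c = (\<Sum>\<pi>\<leftarrow>\<pi>s. nexts (snd (collect \<pi>))) \<and>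
    ((\<forall>\<pi> \<in> set \<pi>s. length (fst (collect \<pi>)) \<le> k) \<longrightarrow> peak \<le> k) \<and>
    (\<forall>\<pi> \<in> set \<pi>s. length (fst (collect \<pi>)) \<le> peak)"
    using assms
  proof (induction \<pi>s arbitrary: t peak c)
    case (Cons \<rho> \<pi>s)
    obtain ps c1 where collect: "collect \<rho> = (ps, c1)" by fastforce
    obtain us c2 where cand: "certify_candidates cert (R \<rho>) ps = (us, c2)" by fastforce
    obtain t' peak' c3 where rest: "certify_leaves collect R cert \<pi>s = (t', peak', c3)"
      by (metis prod_cases3)
    have "peak = max (length ps) peak'" "c = c1 + c2 + c3"
      using Cons.prems by (simp_all add: collect cand rest)
    with Cons.IH[OF rest] certify_candidates_cost[of cert "R \<rho>" ps] show ?case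
      by (auto simp: collect cand le_max_iff_disj)
  qed simp
  then show "lookups c = (\<Sum>\<pi>\<leftarrow>\<pi>s. lookups (snd (collect \<pi>)))"
    and "evals c \<le> (\<Sum>\<pi>\<leftarrow>\<pi>s. evals (snd (collect \<pi>)) + 2 * length (fst (collect \<pi>)))"
    and "nexts c = (\<Sum>\<pi>\<leftarrow>\<pi>s. nexts (snd (collect \<pi>)))"
    and "(\<And>\<pi>. \<pi> \<in> set \<pi>s \<Longrightarrow> length (fst (collect \<pi>)) \<le> k) \<Longrightarrow> peak \<le> k"
    and "\<pi> \<in> set \<pi>s \<Longrightarrow> length (fst (collect \<pi>)) \<le> peak"
    by auto
qed

lemma peak_le_part_size:
  assumes "certify_leaves collect R cert (leaf_paths T) = (t, peak, c)"
    and "\<And>\<pi>. fst (collect \<pi>) = leaf_solutions n \<epsilon> T \<pi> (solutions I (card S))"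
    and "iterates I S" "S \<subseteq> carrier_vec n" "overfull n \<epsilon> S k T = {}"
  shows "peak \<le> k" and "part_size_attained n \<epsilon> S k T \<Longrightarrow> peak = k"
proof -
  have length: "length (fst (collect \<pi>)) = card (region n \<epsilon> T \<pi> \<inter> S)"
    if "\<pi> \<in> set (leaf_paths T)" for \<pi>
    using length_leaf_solutions[OF assms(3,4) that] by (simp add: assms(2))
  show "peak \<le> k"
    using assms(5) length by (intro certify_leaves_cost(4)[OF assms(1)]) (force simp: overfull_def)
  moreover have "k \<le> peak" if "part_size_attained n \<epsilon> S k T"
    using that certify_leaves_cost(5)[OF assms(1)] length by (auto simp: part_size_attained_def)
  ultimately show "part_size_attained n \<epsilon> S k T \<Longrightarrow> peak = k"
    by simp
qed

lemma locate_cost: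
  "lookups (snd (locate n \<epsilon> T p)) = 0 \<and> evals (snd (locate n \<epsilon> T p)) \<le> height T \<and>
   nexts (snd (locate n \<epsilon> T p)) = 0"
  by (induction T) (auto simp: Let_def split_beta)

lemma collect_leaf_result:
  shows "fst (collect_leaf n \<epsilon> I d T \<pi>) = leaf_solutions n \<epsilon> T \<pi> (solutions I d)"
    and "lookups (snd (collect_leaf n \<epsilon> I d T \<pi>)) = 0"
    and "evals (snd (collect_leaf n \<epsilon> I d T \<pi>)) \<le> d * height T"
    and "nexts (snd (collect_leaf n \<epsilon> I d T \<pi>)) = d"
proof -
  let ?inv = "\<lambda>qs ps c. ps = leaf_solutions n \<epsilon> T \<pi> qs \<and>
      lookups c = 0 \<and> evals c \<le> length qs * height T \<and> nexts c = length qs"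
  have "?inv (solutions I d) (fst (collect_leaf n \<epsilon> I d T \<pi>)) (snd (collect_leaf n \<epsilon> I d T \<pi>))"
    unfolding collect_leaf_def
  proof (rule pass_rule[where P = ?inv])
    fix qs p rs a c a' c'
    assume "?inv qs a c" and "(let (\<rho>, c) = locate n \<epsilon> T p
        in (if \<rho> = \<pi> then a @ [p] else a, c + next_call)) = (a', c')"
    then show "?inv (qs @ [p]) a' (c + c')"
      using locate_cost[of n \<epsilon> T p]
      by (auto simp: split_beta leaf_solutions_def leaf_of_def)
  qed (simp add: leaf_solutions_def)
  then show "fst (collect_leaf n \<epsilon> I d T \<pi>) = leaf_solutions n \<epsilon> T \<pi> (solutions I d)"
    and "lookups (snd (collect_leaf n \<epsilon> I d T \<pi>)) = 0"
    and "evals (snd (collect_leaf n \<epsilon> I d T \<pi>)) \<le> d * height T"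
    and "nexts (snd (collect_leaf n \<epsilon> I d T \<pi>)) = d"
    by auto
qed

text \<open>Skipped solutions are free, so the number of calls to \<open>next\<close> is the number of solutions in
  the leaf; in the sum over all leaves every solution is paid for once.\<close>
lemma collect_masked_leaf_result:
  assumes "records n \<epsilon> (solutions I d) M"
  shows "fst (collect_masked_leaf I d M \<pi>) = leaf_solutions n \<epsilon> (splits M) \<pi> (solutions I d)"
    and "lookups (snd (collect_masked_leaf I d M \<pi>)) \<le> d * height M"
    and "evals (snd (collect_masked_leaf I d M \<pi>)) = 0"
    and "nexts (snd (collect_masked_leaf I d M \<pi>)) =
      length (leaf_solutions n \<epsilon> (splits M) \<pi> (solutions I d))"
proof -
  let ?T = "splits M"
  let ?f = "\<lambda>p (pos, ps). let (\<rho>, pos', c) = route M [] pos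
      in if \<rho> = \<pi> then ((pos', ps @ [p]), c + next_call) else ((pos', ps), c)"
  let ?inv = "\<lambda>qs (pos, ps) c. pos = visits n \<epsilon> ?T qs \<and> ps = leaf_solutions n \<epsilon> ?T \<pi> qs \<and>
      lookups c \<le> length qs * height M \<and> evals c = 0 \<and>
      nexts c = length (leaf_solutions n \<epsilon> ?T \<pi> qs)"
  have "?inv (solutions I d) (fst (pass I d ?f (\<lambda>_. 0, []))) (snd (pass I d ?f (\<lambda>_. 0, [])))"
  proof (rule pass_rule[where P = ?inv])
    show "?inv [] (\<lambda>_. 0, []) 0"
      by (auto simp: visits_def leaf_solutions_def)
  next
    fix qs p rs a c a' c'
    assume inv: "?inv qs a c" and sols: "solutions I d = qs @ p # rs" and f: "?f p a = (a', c')"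
    obtain pos ps where a: "a = (pos, ps)" by fastforce
    with inv have pos: "pos = visits n \<epsilon> ?T qs" by simp
    obtain c1 where "route M [] pos = (leaf_of n \<epsilon> ?T p, visits n \<epsilon> ?T (qs @ [p]), c1)"
        "lookups c1 \<le> height M" "evals c1 = 0" "nexts c1 = 0"
      using route_root_correct assms pos sols by metis
    with inv f show "?inv (qs @ [p]) a' (c + c')"
      by (auto simp: a leaf_solutions_def split: if_splits)
  qed
  then show "fst (collect_masked_leaf I d M \<pi>) = leaf_solutions n \<epsilon> ?T \<pi> (solutions I d)"
    and "lookups (snd (collect_masked_leaf I d M \<pi>)) \<le> d * height M"
    and "evals (snd (collect_masked_leaf I d M \<pi>)) = 0"
    and "nexts (snd (collect_masked_leaf I d M \<pi>)) =
      length (leaf_solutions n \<epsilon> ?T \<pi> (solutions I d))"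
    by (simp_all add: collect_masked_leaf_def split_beta)
qed

section \<open>The main algorithm\<close>

lemma solution_bits_eq:
  "real (peak * solution_bits n meth) = 384 * real n * real peak +
     (case meth of Krawczyk \<Rightarrow> 0 | Alpha \<Rightarrow> 128 * real peak)"
  by (cases meth) (simp_all add: solution_bits_def complex_bits_def real_bits_def algebra_simps)

lemma solution_bits_mono:
  assumes "peak \<le> k"
  shows "real (peak * solution_bits n meth) \<le> 384 * real n * real k +
     (case meth of Krawczyk \<Rightarrow> 0 | Alpha \<Rightarrow> 128 * real k)"
  unfolding solution_bits_eq[symmetric] of_nat_le_iff using assms by (rule mult_le_mono1)

text \<open>A tree of height \<open>h\<close> has at most \<open>2 ^ h\<close> leaves, and balanced trees attain this bound, which
  characterizes the perfectly balanced ones.\<close>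
lemma balanced_bsp_tree_height:
  assumes "balanced_bsp_tree n \<epsilon> T"
  shows "size1 T = 2 ^ height T" "log 2 (real (size1 T)) = real (height T)"
proof -
  show log: "log 2 (real (size1 T)) = real (height T)"
    using assms by (simp add: balanced_bsp_tree_def)
  have "real (size1 T) = 2 powr real (height T)"
    unfolding log[symmetric] by (subst powr_log_cancel) (auto simp: size1_size)
  then have "real (size1 T) = real (2 ^ height T)"
    by (simp add: powr_realpow)
  then show "size1 T = 2 ^ height T"
    by (simp only: of_nat_eq_iff)
qed

lemma masked_main_algorithm_cost:
  assumes "masked_main_algorithm n \<epsilon> I S k meth cert M t space c"
    and "balanced_bsp_tree n \<epsilon> (splits M)" "S \<subseteq> carrier_vec n" "iterates I S"
  defines "h \<equiv> height M"
  shows "h \<ge> 1"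
    and "\<exists>peak \<le> k. (part_size_attained n \<epsilon> S k (splits M) \<longrightarrow> peak = k) \<and>
      space = card S * h + peak * solution_bits n meth"
    and "lookups c \<le> card S * size1 M * h + card S * h\<^sup>2"
    and "evals c \<le> 3 * card S * h" "nexts c \<le> 2 * card S * h"
proof -
  let ?d = "card S"
  let ?collect = "collect_masked_leaf I ?d M"
  obtain c1 c2 peak where build: "build_masked_bsp_tree n \<epsilon> I S k M c1"
      and cert: "certify_leaves ?collect (region n \<epsilon> (splits M)) cert (leaf_paths M) = (t, peak, c2)"
      and space: "space = masked_tree_bits M + peak * solution_bits n meth"
      and c: "c = c1 + c2"
    using assms(1) by (auto simp: masked_main_algorithm_def certify_masked_iterator_def)
  have state: "masked_build_state n \<epsilon> I S k M c1" and full: "overfull n \<epsilon> S k (splits M) = {}"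
    using build by (simp_all add: build_masked_bsp_tree_def)
  have inv: "records n \<epsilon> (solutions I ?d) M" "h \<ge> 1"
      "lookups c1 \<le> ?d * h\<^sup>2" "evals c1 \<le> ?d * h" "nexts c1 \<le> ?d * h"
    using masked_build_state_invariant[OF state] by (simp_all add: h_def)
  note collect = collect_masked_leaf_result[OF inv(1)]
  note cost = certify_leaves_cost[OF cert]
  have sum: "(\<Sum>\<pi>\<leftarrow>leaf_paths M. length (leaf_solutions n \<epsilon> (splits M) \<pi> (solutions I ?d))) = ?d"
    using sum_length_leaf_solutions[of n \<epsilon> "splits M"] by simp
  have d: "?d \<le> ?d * h"
    using inv(2) by simp
  show "h \<ge> 1" by (rule inv(2))
  have "Tree.complete M"
    using balanced_bsp_tree_height(1)[OF assms(2)] by (intro complete_if_size1_height) simp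
  then have "masked_tree_bits M = ?d * h"
    using masked_tree_bits_complete[OF inv(1)] by (simp add: h_def)
  moreover have "peak \<le> k" "part_size_attained n \<epsilon> S k (splits M) \<longrightarrow> peak = k"
    using peak_le_part_size[where T = "splits M", OF _ collect(1) assms(4,3) full] cert by auto
  ultimately show "\<exists>peak \<le> k. (part_size_attained n \<epsilon> S k (splits M) \<longrightarrow> peak = k) \<and>
      space = ?d * h + peak * solution_bits n meth"
    using space by auto
  have "lookups c2 \<le> (\<Sum>\<pi>\<leftarrow>leaf_paths M. ?d * h)"
    unfolding cost(1) h_def by (intro sum_list_mono collect(2))
  also have "\<dots> = ?d * size1 M * h"
    by (simp add: sum_list_triv length_leaf_paths)
  finally show "lookups c \<le> ?d * size1 M * h + ?d * h\<^sup>2"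
    using inv(3) by (simp add: c)
  have "evals c2 \<le> 2 * ?d"
    using cost(2) by (simp add: collect sum sum_list_const_mult)
  then show "evals c \<le> 3 * ?d * h"
    using inv(4) d unfolding c counts_simps mult.assoc by linarith
  have "nexts c2 = ?d"
    using cost(3) by (simp add: collect sum)
  then show "nexts c \<le> 2 * ?d * h"
    using inv(5) d unfolding c counts_simps mult.assoc by linarith
qed

lemma main_algorithm_cost:
  assumes "main_algorithm n \<epsilon> I S k meth cert T t space c"
    and "S \<subseteq> carrier_vec n" "iterates I S"
  defines "h \<equiv> height T"
  shows "\<exists>peak \<le> k. (part_size_attained n \<epsilon> S k T \<longrightarrow> peak = k) \<and>
      space = 64 * size T + peak * solution_bits n meth"
    and "lookups c = 0"
    and "evals c \<le> 5 * card S * size1 T * h" "nexts c \<le> 3 * card S * size1 T"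
proof -
  let ?d = "card S"
  let ?collect = "collect_leaf n \<epsilon> I ?d T"
  obtain c1 c2 peak where build: "build_bsp_tree n \<epsilon> I S k T c1"
      and cert: "certify_leaves ?collect (region n \<epsilon> T) cert (leaf_paths T) = (t, peak, c2)"
      and space: "space = tree_bits T + peak * solution_bits n meth"
      and c: "c = c1 + c2"
    using assms(1) by (auto simp: main_algorithm_def certify_iterator_def)
  have state: "build_state n \<epsilon> I S k T c1" and full: "overfull n \<epsilon> S k T = {}"
    using build by (simp_all add: build_bsp_tree_def)
  have inv: "h \<ge> 1" "lookups c1 = 0" "evals c1 \<le> 2 * ?d * h * size T" "nexts c1 = 2 * ?d * size T"
    using build_state_invariant[OF state] by (simp_all add: h_def)
  note collect = collect_leaf_result[of n \<epsilon> I ?d T]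
  note cost = certify_leaves_cost[OF cert]
  have "peak \<le> k" "part_size_attained n \<epsilon> S k T \<longrightarrow> peak = k"
    using peak_le_part_size[OF cert collect(1) assms(3,2) full] by auto
  then show "\<exists>peak \<le> k. (part_size_attained n \<epsilon> S k T \<longrightarrow> peak = k) \<and>
      space = 64 * size T + peak * solution_bits n meth"
    using space by (auto simp: tree_bits_def real_bits_def)
  show "lookups c = 0"
    using cost(1) inv(2) by (simp add: c collect)
  have "evals c2 \<le> (\<Sum>\<pi>\<leftarrow>leaf_paths T. evals (snd (?collect \<pi>))) +
      (\<Sum>\<pi>\<leftarrow>leaf_paths T. 2 * length (fst (?collect \<pi>)))"
    using cost(2) by (simp add: sum_list_addf)
  also have "(\<Sum>\<pi>\<leftarrow>leaf_paths T. 2 * length (fst (?collect \<pi>))) = 2 * ?d"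
    by (simp add: collect(1) sum_list_const_mult sum_length_leaf_solutions)
  also have "(\<Sum>\<pi>\<leftarrow>leaf_paths T. evals (snd (?collect \<pi>))) \<le> (\<Sum>\<pi>\<leftarrow>leaf_paths T. ?d * h)"
    unfolding h_def by (intro sum_list_mono collect(3))
  also have "(\<Sum>\<pi>\<leftarrow>leaf_paths T. ?d * h) = ?d * size1 T * h"
    by (simp add: sum_list_triv length_leaf_paths)
  also have "2 * ?d \<le> 2 * (?d * size1 T * h)"
  proof -
    have "1 * 1 \<le> size1 T * h"
      using inv(1) by (intro mult_le_mono) (simp_all add: size1_size)
    then have "?d * 1 \<le> ?d * (size1 T * h)"
      by (intro mult_le_mono2) simp
    then show ?thesis by (simp only: mult.assoc mult_1_right mult_le_mono2)
  qed
  finally have "evals c2 \<le> 3 * (?d * size1 T * h)"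
    by (simp add: algebra_simps)
  moreover have "evals c1 \<le> 2 * (?d * size1 T * h)"
    using inv(3) by (rule order_trans) (simp add: size1_size algebra_simps)
  ultimately show "evals c \<le> 5 * ?d * size1 T * h"
    by (simp add: c)
  have "nexts c2 = ?d * size1 T"
    using cost(3) by (simp add: collect sum_list_triv length_leaf_paths)
  then show "nexts c \<le> 3 * ?d * size1 T"
    using inv(4) by (simp add: c size1_size)
qed

theorem theorem5:
  shows "\<exists>C::real. C > 0 \<and>
    (\<forall>(n::nat) (\<epsilon>::real) (F::mpoly list) (S::complex vec set) (I::solution_iterator) (k::nat)
       (cert::certifier) (meth::cert_method) (t::cert_totals) (space::nat) (c::counts).
     n \<ge> 1 \<longrightarrow> \<epsilon> > 0 \<longrightarrow> square_system n F \<longrightarrow> S \<subseteq> carrier_vec n \<longrightarrow> iterates I S \<longrightarrow>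
     valid_certifier n F meth cert \<longrightarrow>
     (\<forall>M::masked_tree.
        masked_main_algorithm n \<epsilon> I S k meth cert M t space c \<longrightarrow>
        balanced_bsp_tree n \<epsilon> (splits M) \<longrightarrow>
        (let d = real (card S); m = real (size1 M);
             bits = d * log 2 m + 384 * real n * real k +
                    (case meth of Krawczyk \<Rightarrow> 0 | Alpha \<Rightarrow> 128 * real k)
         in real space \<le> bits \<and>
            (part_size_attained n \<epsilon> S k (splits M) \<longrightarrow> real space = bits) \<and>
            real (lookups c) \<le> C * (d * m * log 2 m + d * (log 2 m) ^ 3) \<and>
            real (evals c) \<le> C * (d * log 2 m) \<and>
            real (nexts c) \<le> C * (d * log 2 m))) \<and>
     (\<forall>T::split_tree.
        main_algorithm n \<epsilon> I S k meth cert T t space c \<longrightarrow>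
        balanced_bsp_tree n \<epsilon> T \<longrightarrow>
        (let d = real (card S); m = real (size1 T);
             bits = 64 * (m - 1) + 384 * real n * real k +
                    (case meth of Krawczyk \<Rightarrow> 0 | Alpha \<Rightarrow> 128 * real k)
         in real space \<le> bits \<and>
            (part_size_attained n \<epsilon> S k T \<longrightarrow> real space = bits) \<and>
            lookups c = 0 \<and>
            real (evals c) \<le> C * (d * m * log 2 m) \<and>
            real (nexts c) \<le> C * (d * m))))"
  \<comment> \<open>The constant comes from the comparisons without bitmasks: two passes for each of at most \<open>m\<close>
    splits and one pass for each leaf, with \<open>d * h\<close> comparisons per pass, and \<open>2 * d\<close> comparisons for
    the certificate regions, which are bounded by another \<open>2 * d * m * h\<close>.\<close>
proof (intro exI[of _ 5] conjI allI impI)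
  show "(0::real) < 5" by simp
next
  fix n :: nat and \<epsilon> :: real and F :: "mpoly list" and S :: "complex vec set"
    and I :: solution_iterator and k :: nat and cert :: certifier and meth :: cert_method
    and t :: cert_totals and "space" :: nat and c :: counts and M :: masked_tree
  assume S: "S \<subseteq> carrier_vec n" "iterates I S"
    and alg: "masked_main_algorithm n \<epsilon> I S k meth cert M t space c"
    and balanced: "balanced_bsp_tree n \<epsilon> (splits M)"
  note cost = masked_main_algorithm_cost[OF alg balanced S]
  define d where "d = real (card S)"
  define m where "m = real (size1 M)"
  define h where "h = real (height M)"
  have log: "log 2 m = h"
    using balanced_bsp_tree_height(2)[OF balanced] by (simp add: m_def h_def)
  have nonneg: "d \<ge> 0" "m \<ge> 0" "h \<ge> 1"
    using cost(1) by (simp_all add: d_def m_def h_def)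
  obtain peak where peak: "peak \<le> k" "part_size_attained n \<epsilon> S k (splits M) \<longrightarrow> peak = k"
      "space = card S * height M + peak * solution_bits n meth"
    using cost(2) by blast
  then have "space": "real space = d * h + real (peak * solution_bits n meth)"
    by (simp add: d_def h_def)
  \<comment> \<open>As \<open>h \<ge> 1\<close>, the quadratic bound for the construction is at most the cubic one.\<close>
  have "real (lookups c) \<le> d * m * h + d * h ^ 2"
    using cost(3)[folded of_nat_le_iff[where 'a = real]] by (simp add: d_def m_def h_def)
  also have "\<dots> \<le> d * m * h + d * h ^ 3"
    using nonneg by (intro add_left_mono mult_left_mono power_increasing) auto
  also have "\<dots> \<le> 5 * (d * m * h + d * h ^ 3)"
    using nonneg by simp
  finally have lookups: "real (lookups c) \<le> 5 * (d * m * h + d * h ^ 3)" .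
  have dh: "0 \<le> d * h"
    using nonneg by simp
  have "real (evals c) \<le> 3 * (d * h)" "real (nexts c) \<le> 2 * (d * h)"
    using cost(4,5)[folded of_nat_le_iff[where 'a = real]] by (simp_all add: d_def h_def)
  with dh have "real (evals c) \<le> 5 * (d * h)" "real (nexts c) \<le> 5 * (d * h)"
    by linarith+
  with peak(2) "space" lookups solution_bits_mono[OF peak(1), of n meth]
  show "let d = real (card S); m = real (size1 M);
             bits = d * log 2 m + 384 * real n * real k +
                    (case meth of Krawczyk \<Rightarrow> 0 | Alpha \<Rightarrow> 128 * real k)
         in real space \<le> bits \<and>
            (part_size_attained n \<epsilon> S k (splits M) \<longrightarrow> real space = bits) \<and>
            real (lookups c) \<le> 5 * (d * m * log 2 m + d * (log 2 m) ^ 3) \<and>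
            real (evals c) \<le> 5 * (d * log 2 m) \<and>
            real (nexts c) \<le> 5 * (d * log 2 m)"
    unfolding Let_def d_def[symmetric] m_def[symmetric] log
    by (auto simp: solution_bits_eq simp del: of_nat_mult)
next
  fix n :: nat and \<epsilon> :: real and F :: "mpoly list" and S :: "complex vec set"
    and I :: solution_iterator and k :: nat and cert :: certifier and meth :: cert_method
    and t :: cert_totals and "space" :: nat and c :: counts and T :: split_tree
  assume S: "S \<subseteq> carrier_vec n" "iterates I S"
    and alg: "main_algorithm n \<epsilon> I S k meth cert T t space c"
    and balanced: "balanced_bsp_tree n \<epsilon> T"
  note cost = main_algorithm_cost[OF alg S]
  define d where "d = real (card S)"
  define m where "m = real (size1 T)"
  define h where "h = real (height T)"
  have log: "log 2 m = h"
    using balanced_bsp_tree_height(2)[OF balanced] by (simp add: m_def h_def)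
  obtain peak where peak: "peak \<le> k" "part_size_attained n \<epsilon> S k T \<longrightarrow> peak = k"
      "space = 64 * size T + peak * solution_bits n meth"
    using cost(1) by blast
  then have "space": "real space = 64 * (m - 1) + real (peak * solution_bits n meth)"
    by (simp add: m_def size1_size)
  have "0 \<le> d * m"
    by (simp add: d_def m_def)
  moreover have "real (evals c) \<le> 5 * (d * m * h)" "real (nexts c) \<le> 3 * (d * m)"
    using cost(3,4)[folded of_nat_le_iff[where 'a = real]] by (simp_all add: d_def m_def h_def)
  ultimately have "real (evals c) \<le> 5 * (d * m * h)" "real (nexts c) \<le> 5 * (d * m)"
    by linarith+
  with peak(2) "space" cost(2) solution_bits_mono[OF peak(1), of n meth]
  show "let d = real (card S); m = real (size1 T);
             bits = 64 * (m - 1) + 384 * real n * real k +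
                    (case meth of Krawczyk \<Rightarrow> 0 | Alpha \<Rightarrow> 128 * real k)
         in real space \<le> bits \<and>
            (part_size_attained n \<epsilon> S k T \<longrightarrow> real space = bits) \<and>
            lookups c = 0 \<and>
            real (evals c) \<le> 5 * (d * m * log 2 m) \<and>
            real (nexts c) \<le> 5 * (d * m)"
    unfolding Let_def d_def[symmetric] m_def[symmetric] log
    by (auto simp: solution_bits_eq simp del: of_nat_mult)
qed

end
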